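(* If $\{A_n\}_{n\ge0}$ is an even sequence, then for all nonnegative integers $m$ and $n$, $$\sum_{k=0}^n\binom nk(-1)^kA_{k+m}=\sum_{k=0}^m\binom mk(-1)^kA_{k+n}.$$ If $\{A_n\}_{n\ge0}$ is an odd sequence, then for all nonnegative integers $m$ and $n$, $$\sum_{k=0}^n\binom nk(-1)^kA_{k+m}=-\sum_{k=0}^m\binom mk(-1)^kA_{k+n}.$$
   Context: A sequence $\{a_n\}_{n\ge0}$ of real (or complex) numbers is called an even sequence if $\sum_{k=0}^n\binom nk(-1)^ka_k=a_n$ for all $n=0,1,2,\ldots$, and an odd sequence if $\sum_{k=0}^n\binom nk(-1)^ka_k=-a_n$ for all $n=0,1,2,\ldots$. *)

theory Defs
  imports Complex_Main
begin

text \<open>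
  Sequences take values in a real normed field; \<^typ>\<open>real\<close> and \<^typ>\<open>complex\<close> are instances,
  and by the Gelfand--Mazur theorem every instance is isomorphic to one of these two.
\<close>

definition even_sequence :: "(nat \<Rightarrow> 'a::real_normed_field) \<Rightarrow> bool" where
  "even_sequence a \<longleftrightarrow> (\<forall>n. (\<Sum>k=0..n. of_nat (n choose k) * (- 1) ^ k * a k) = a n)"

definition odd_sequence :: "(nat \<Rightarrow> 'a::real_normed_field) \<Rightarrow> bool" where
  "odd_sequence a \<longleftrightarrow> (\<forall>n. (\<Sum>k=0..n. of_nat (n choose k) * (- 1) ^ k * a k) = - a n)"

end

(* Write T(m,n) for the left-hand sums. Pascal's rule gives T(m+1,n) = T(m,n) - T(m,n+1).
   Being even or odd says T(0,n) = c T(n,0) with c = 1 or c = -1, and the recurrence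
   propagates this to T(m,n) = c T(n,m) by induction on m. *)
theory Submission
  imports Defs
begin

text \<open>Up to the sign \<open>(- 1) ^ n\<close>, this is the \<open>n\<close>-th forward
  difference of \<open>a\<close> at \<open>m\<close>.\<close>

definition alt_binomial_sum :: "(nat \<Rightarrow> 'a::comm_ring_1) \<Rightarrow> nat \<Rightarrow> nat \<Rightarrow> 'a" where
  "alt_binomial_sum a m n = (\<Sum>k=0..n. of_nat (n choose k) * (- 1) ^ k * a (k + m))"

lemma alt_binomial_sum_0_right [simp]: "alt_binomial_sum a m 0 = a m"
  by (simp add: alt_binomial_sum_def)

lemma alt_binomial_sum_Suc_right:
  "alt_binomial_sum a m (Suc n) = alt_binomial_sum a m n - alt_binomial_sum a (Suc m) n"
proof -
  define g where "g k = of_nat (n choose k) * (- 1) ^ k * a (k + m)" for k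
  define h where "h k = of_nat (n choose k) * (- 1) ^ k * a (k + Suc m)" for k
  have "alt_binomial_sum a m (Suc n)
      = a m + (\<Sum>k\<le>n. of_nat (Suc n choose Suc k) * (- 1) ^ Suc k * a (Suc k + m))"
    unfolding alt_binomial_sum_def atLeast0AtMost by (subst sum.atMost_Suc_shift) simp
  \<comment> \<open>Pascal's rule splits \<open>Suc n choose Suc k\<close>: the part
    \<open>n choose Suc k\<close> gives \<open>g (Suc k)\<close>, while \<open>n choose k\<close>
    keeps the extra sign and gives \<open>- h k\<close>.\<close>
  also have "\<dots> = a m + (\<Sum>k\<le>n. g (Suc k) - h k)"
    by (intro arg_cong2[where f = "(+)"] sum.cong refl) (simp add: g_def h_def algebra_simps)
  \<comment> \<open>The isolated \<open>a m\<close> is \<open>g 0\<close>, so it completes the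
    shifted sum of \<open>g\<close>. The surplus top term \<open>g (Suc n)\<close> vanishes because
    \<open>n choose Suc n\<close> is 0.\<close>
  also have "\<dots> = (\<Sum>k\<le>Suc n. g k) - (\<Sum>k\<le>n. h k)"
    by (subst sum.atMost_Suc_shift) (simp add: sum_subtractf g_def)
  also have "(\<Sum>k\<le>Suc n. g k) = (\<Sum>k\<le>n. g k)"
    by (simp add: g_def binomial_eq_0)
  finally show ?thesis
    by (simp add: alt_binomial_sum_def atLeast0AtMost g_def h_def)
qed

lemma alt_binomial_sum_swap:
  assumes "\<And>n. alt_binomial_sum a 0 n = c * a n"
  shows "alt_binomial_sum a m n = c * alt_binomial_sum a n m"
\<comment> \<open>\<open>n\<close> has to vary, since the step uses the hypothesis at both
  \<open>n\<close> and \<open>Suc n\<close>.\<close>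
proof (induction m arbitrary: n)
  case 0
  then show ?case by (simp add: assms)
next
  case (Suc m)
  have "alt_binomial_sum a (Suc m) n = alt_binomial_sum a m n - alt_binomial_sum a m (Suc n)"
    by (simp add: alt_binomial_sum_Suc_right)
  \<comment> \<open>After both swaps the difference is \<open>c\<close> times
    \<open>alt_binomial_sum a n m - alt_binomial_sum a (Suc n) m\<close>, which is the same
    recurrence with the roles of \<open>m\<close> and \<open>n\<close> exchanged.\<close>
  also have "\<dots> = c * alt_binomial_sum a n (Suc m)"
    by (simp add: Suc.IH[of n] Suc.IH[of "Suc n"] alt_binomial_sum_Suc_right[of a n] right_diff_distrib)
  finally show ?case .
qed

theorem theorem2p11:
  fixes A :: "nat \<Rightarrow> 'a::real_normed_field"
  shows "(even_sequence A \<longrightarrow>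
           (\<forall>m n. (\<Sum>k=0..n. of_nat (n choose k) * (- 1) ^ k * A (k + m))
                = (\<Sum>k=0..m. of_nat (m choose k) * (- 1) ^ k * A (k + n)))) \<and>
         (odd_sequence A \<longrightarrow>
           (\<forall>m n. (\<Sum>k=0..n. of_nat (n choose k) * (- 1) ^ k * A (k + m))
                = - (\<Sum>k=0..m. of_nat (m choose k) * (- 1) ^ k * A (k + n))))"
proof (intro conjI impI allI)
  fix m n
  assume "even_sequence A"
  \<comment> \<open>The factor 1 is kept explicit so that the swap lemma unifies with
    \<open>c = 1\<close>.\<close>
  then have "alt_binomial_sum A 0 k = 1 * A k" for k
    by (simp add: even_sequence_def alt_binomial_sum_def)
  from alt_binomial_sum_swap[OF this, of m n]
  show "(\<Sum>k=0..n. of_nat (n choose k) * (- 1) ^ k * A (k + m))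
      = (\<Sum>k=0..m. of_nat (m choose k) * (- 1) ^ k * A (k + n))"
    unfolding alt_binomial_sum_def mult_1_left .
next
  fix m n
  assume "odd_sequence A"
  then have "alt_binomial_sum A 0 k = - 1 * A k" for k
    by (simp add: odd_sequence_def alt_binomial_sum_def)
  from alt_binomial_sum_swap[OF this, of m n]
  show "(\<Sum>k=0..n. of_nat (n choose k) * (- 1) ^ k * A (k + m))
      = - (\<Sum>k=0..m. of_nat (m choose k) * (- 1) ^ k * A (k + n))"
    unfolding alt_binomial_sum_def mult_minus1 .
qed

end
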